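(* Let $\alpha>-1$ with $\alpha\neq0$ and let $u\in\mathcal{V}_\alpha$. Assume that there is a sequence $\{z_j\}$ in $\mathbb{H}$ with $|z_j|\to\infty$ as $j\to\infty$ such that $$\lim_{j\to\infty}\frac{u(z_j)}{(\operatorname{Im} z_j)^{\alpha+1}}=0.$$ Then $u(z)=0$ for all $z\in\mathbb{H}$.
   Context: $\mathbb{H}=\{z\in\mathbb{C}:\operatorname{Im} z>0\}$ is the open upper half-plane. Pochhammer symbols: $(a)_0=1$ and $(a)_k=\prod_{j=0}^{k-1}(a+j)$ for $k\geq1$. For $k\in\mathbb{N}=\{0,1,2,\dots\}$ set $$p_{k,\alpha}(z)=\sum_{j=0}^k\frac{(\alpha+1)_j}{j!}\,z^{k-j}\bar z^{\,j}.$$ $\mathcal{V}_\alpha$ is the set of all functions on $\mathbb{H}$ of the form $u(z)=\sum_{k=0}^n c_k(\operatorname{Im} z)^{\alpha+1}p_{k,\alpha}(z)$, $z\in\mathbb{H}$, for some $n\in\mathbb{N}$ and $c_0,\dots,c_n\in\mathbb{C}$. *)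

theory Defs
  imports "HOL-Analysis.Analysis"
begin

definition upper_half_plane :: "complex set" where
  "upper_half_plane = {z. Im z > 0}"

definition p_poly :: "nat \<Rightarrow> real \<Rightarrow> complex \<Rightarrow> complex" where
  "p_poly k \<alpha> z =
     (\<Sum>j=0..k. of_real (pochhammer (\<alpha> + 1) j / fact j) * z ^ (k - j) * cnj z ^ j)"

(* A function on the upper half-plane is represented by a total function on the
   complex numbers; only its values on the half-plane are constrained. *)
definition V_space :: "real \<Rightarrow> (complex \<Rightarrow> complex) set" where
  "V_space \<alpha> = {u. \<exists>(n::nat) (c :: nat \<Rightarrow> complex). \<forall>z\<in>upper_half_plane.
     u z = (\<Sum>k=0..n. c k * of_real (Im z powr (\<alpha> + 1)) * p_poly k \<alpha> z)}"

end

theory Submission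
  imports Defs
begin

text \<open>
  On the unit circle, \<open>p\<^sub>k(z)\<close> is \<open>z\<^sup>k\<close> times a polynomial in \<open>cnj z\<^sup>2\<close> whose positive coefficients
  \<open>(\<alpha>+1)\<^sub>j / j!\<close> are strictly increasing for \<open>\<alpha> > 0\<close> and strictly decreasing for \<open>\<alpha> < 0\<close>. By the
  Enestrom--Kakeya argument such a polynomial has no zero on the circle, so compactness and
  homogeneity give \<open>\<delta> |z|\<^sup>k \<le> |p\<^sub>k(z)| \<le> B |z|\<^sup>k\<close>. Hence the top coefficient of a combination of
  the \<open>p\<^sub>k\<close> that tends to zero along \<open>z\<^sub>j \<rightarrow> \<infinity>\<close> vanishes, and so inductively do all the others.
\<close>

text \<open>Summation by parts: the factor \<open>1 - w\<close> replaces the coefficients by their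
  consecutive differences, whose signs are what monotonicity controls.\<close>

lemma Enestrom_Kakeya_telescope:
  fixes a :: "nat \<Rightarrow> real" and w :: complex
  shows "(1 - w) * (\<Sum>j\<le>k. of_real (a j) * w ^ j) =
    of_real (a 0) - (\<Sum>j<k. of_real (a j - a (Suc j)) * w ^ Suc j) - of_real (a k) * w ^ Suc k"
  by (induction k) (simp_all add: algebra_simps)

text \<open>At a zero, the telescoped identity writes \<open>a 0\<close> as a combination of
  \<open>w\<close>, ..., \<open>w ^ Suc k\<close> with positive weights
  \<open>a j - a (Suc j)\<close> and \<open>a k\<close>, which add up to \<open>a 0\<close>. All
  these powers have real part at most 1, and \<open>w\<close> itself has a smaller one unless
  \<open>w = 1\<close>, so comparing real parts is contradictory.\<close>

lemma sum_decreasing_coeffs_nonzero_on_circle: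
  fixes a :: "nat \<Rightarrow> real" and w :: complex
  assumes pos: "\<And>j. j \<le> k \<Longrightarrow> 0 < a j"
    and dec: "\<And>j. j < k \<Longrightarrow> a (Suc j) < a j"
    and w: "norm w = 1"
  shows "(\<Sum>j\<le>k. of_real (a j) * w ^ j) \<noteq> 0"
proof
  assume zero: "(\<Sum>j\<le>k. of_real (a j) * w ^ j) = 0"
  show False
  \<comment> \<open>At \<open>w = 1\<close> the factor \<open>1 - w\<close> kills all information,
    but there the sum is just a sum of positive reals.\<close>
  proof (cases "w = 1")
    case True
    have "of_real (\<Sum>j\<le>k. a j) = (0::complex)"
      using zero True by simp
    then have "(\<Sum>j\<le>k. a j) = 0"
      using of_real_eq_0_iff by blast
    moreover have "0 < (\<Sum>j\<le>k. a j)"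
      using pos by (intro sum_pos) auto
    ultimately show False by simp
  next
    case False
    have Re_le: "Re (w ^ j) \<le> 1" for j
      using complex_Re_le_cmod[of "w ^ j"] w by (simp add: norm_power)
    have Re_less: "Re w < 1"
    proof (rule ccontr)
      assume "\<not> Re w < 1"
      then have "Re w = 1" using Re_le[of 1] by simp
      moreover have "(Re w)\<^sup>2 + (Im w)\<^sup>2 = 1"
        using w cmod_power2[of w] by simp
      ultimately show False
        using False by (simp add: complex_eq_iff)
    qed
    define D where "D j = (a j - a (Suc j)) * Re (w ^ Suc j)" for j
    have "of_real (a 0) - (\<Sum>j<k. of_real (a j - a (Suc j)) * w ^ Suc j)
        - of_real (a k) * w ^ Suc k = 0"
      using zero Enestrom_Kakeya_telescope[of w a k] by simp
    then have "Re (of_real (a 0) - (\<Sum>j<k. of_real (a j - a (Suc j)) * w ^ Suc j)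
        - of_real (a k) * w ^ Suc k) = 0"
      by (metis zero_complex.sel(1))
    then have eq: "a 0 = (\<Sum>j<k. D j) + a k * Re (w ^ Suc k)"
      by (simp add: D_def del: power_Suc)
    have last_le: "a k * Re (w ^ Suc k) \<le> a k"
      using pos[of k] Re_le[of "Suc k"] mult_left_mono[of "Re (w ^ Suc k)" 1 "a k"] by simp
    have D_le: "D j \<le> a j - a (Suc j)" if "j < k" for j
      using dec[OF that] Re_le[of "Suc j"]
        mult_left_mono[of "Re (w ^ Suc j)" 1 "a j - a (Suc j)"] by (simp add: D_def)
    have telescope: "(\<Sum>j<k. a j - a (Suc j)) = a 0 - a k"
      by (rule sum_lessThan_telescope')
    \<comment> \<open>The strict inequality comes from the first power of \<open>w\<close>. Its
      weight is \<open>a 0 - a 1\<close> if \<open>k > 0\<close>, but \<open>a k\<close> itself if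
      \<open>k = 0\<close>.\<close>
    show False
    proof (cases "k = 0")
      case True
      then show False using eq pos[of 0] Re_less by simp
    next
      case False
      have "D 0 < a 0 - a (Suc 0)"
        using dec[of 0] False Re_less by (simp add: D_def)
      then have "(\<Sum>j<k. D j) < (\<Sum>j<k. a j - a (Suc j))"
        using D_le False by (intro sum_strict_mono_ex1) auto
      then show False using eq last_le telescope by simp
    qed
  qed
qed

lemma p_poly_scale: "p_poly k \<alpha> (of_real r * z) = of_real (r ^ k) * p_poly k \<alpha> z"
proof -
  have "r ^ k = r ^ (k - j) * r ^ j" if "j \<le> k" for j
    using that by (simp flip: power_add)
  then have "of_real r ^ k = (of_real r ^ (k - j) * of_real r ^ j :: complex)" if "j \<le> k" for j
    using that by (metis of_real_mult of_real_power)
  then show ?thesis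
    unfolding p_poly_def sum_distrib_left
    by (intro sum.cong) (auto simp: power_mult_distrib)
qed

text \<open>The value \<alpha> = 0 makes all coefficients equal, and then zeros do occur: for
  \<open>k = 1\<close> the polynomial is \<open>z + cnj z\<close>, which vanishes at
  \<open>\<i>\<close>.\<close>

lemma p_poly_nonzero_on_circle:
  assumes \<alpha>: "\<alpha> > -1" "\<alpha> \<noteq> 0" and z: "norm z = 1"
  shows "p_poly k \<alpha> z \<noteq> 0"
proof -
  define a where "a j = pochhammer (\<alpha> + 1) j / fact j" for j
  have a_pos: "0 < a j" for j
    using \<alpha> by (simp add: a_def pochhammer_pos)
  \<comment> \<open>The sign of \<alpha> alone decides whether the coefficients increase or
    decrease.\<close>
  have a_Suc: "a (Suc j) - a j = a j * (\<alpha> / (1 + real j))" for j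
  proof -
    have "a (Suc j) = a j * ((\<alpha> + 1 + real j) / (1 + real j))"
      by (simp add: a_def pochhammer_Suc mult.commute)
    then show ?thesis by (simp add: field_simps)
  qed
  have unit: "z * cnj z = 1"
    using z by (simp add: complex_norm_square[symmetric])
  have unit_pow: "z ^ j * cnj z ^ j = 1" for j
    using unit by (metis power_mult_distrib power_one)
  have nz: "z \<noteq> 0" "cnj z \<noteq> 0" using z by auto
  have expand: "p_poly k \<alpha> z = (\<Sum>j\<le>k. of_real (a j) * z ^ (k - j) * cnj z ^ j)"
    by (simp add: p_poly_def a_def atMost_atLeast0)
  show ?thesis
  proof (cases "\<alpha> < 0")
    case True
    have "z ^ (k - j) * cnj z ^ j = z ^ k * ((cnj z)\<^sup>2) ^ j" if "j \<le> k" for j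
    proof -
      have "z ^ k * ((cnj z)\<^sup>2) ^ j = z ^ (k - j) * (z ^ j * cnj z ^ j) * cnj z ^ j"
        using that by (simp add: power_mult[symmetric] mult_2 power_add[symmetric] mult.assoc[symmetric])
      then show ?thesis by (simp add: unit_pow)
    qed
    then have "p_poly k \<alpha> z = z ^ k * (\<Sum>j\<le>k. of_real (a j) * ((cnj z)\<^sup>2) ^ j)"
      unfolding expand sum_distrib_left by (intro sum.cong) (auto simp: mult.assoc mult.left_commute)
    moreover have "a (Suc j) < a j" for j
    proof -
      have "a j * (\<alpha> / (1 + real j)) < 0"
        using a_pos[of j] True by (intro mult_pos_neg divide_neg_pos) auto
      then show ?thesis using a_Suc[of j] by simp
    qed
    then have "(\<Sum>j\<le>k. of_real (a j) * ((cnj z)\<^sup>2) ^ j) \<noteq> 0"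
      using a_pos z by (intro sum_decreasing_coeffs_nonzero_on_circle) (auto simp: norm_power)
    ultimately show ?thesis using nz by simp
  next
    \<comment> \<open>For increasing coefficients the order of summation is reversed and
      \<open>cnj z ^ k\<close> is factored out instead of \<open>z ^ k\<close>. This leaves a
      polynomial in \<open>z\<^sup>2\<close> with decreasing coefficients.\<close>
    case False
    have "z ^ j * cnj z ^ (k - j) = cnj z ^ k * (z\<^sup>2) ^ j" if "j \<le> k" for j
    proof -
      have "cnj z ^ k * (z\<^sup>2) ^ j = cnj z ^ (k - j) * (z ^ j * cnj z ^ j) * z ^ j"
        using that by (simp add: power_mult[symmetric] mult_2 power_add mult_ac)
          (simp add: mult_2_right flip: power_add)
      then show ?thesis by (simp add: unit_pow)
    qed
    moreover have "p_poly k \<alpha> z = (\<Sum>j\<le>k. of_real (a (k - j)) * z ^ j * cnj z ^ (k - j))"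
      unfolding expand by (rule sum.reindex_bij_witness[of _ "\<lambda>j. k - j" "\<lambda>j. k - j"]) auto
    ultimately have "p_poly k \<alpha> z = cnj z ^ k * (\<Sum>j\<le>k. of_real (a (k - j)) * (z\<^sup>2) ^ j)"
      unfolding sum_distrib_left by (simp add: mult.assoc mult.left_commute)
    moreover have inc: "a j < a (Suc j)" for j
    proof -
      have "0 < a j * (\<alpha> / (1 + real j))"
        using a_pos[of j] False \<alpha> by (intro mult_pos_pos divide_pos_pos) auto
      then show ?thesis using a_Suc[of j] by simp
    qed
    have "a (k - Suc j) < a (k - j)" if "j < k" for j
      using inc[of "k - Suc j"] that by (simp add: Suc_diff_Suc)
    then have "(\<Sum>j\<le>k. of_real (a (k - j)) * (z\<^sup>2) ^ j) \<noteq> 0"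
      using a_pos z
      by (intro sum_decreasing_coeffs_nonzero_on_circle[where a = "\<lambda>j. a (k - j)"])
        (auto simp: norm_power)
    ultimately show ?thesis using nz by simp
  qed
qed

lemma continuous_on_p_poly: "continuous_on S (p_poly k \<alpha>)"
  unfolding p_poly_def[abs_def] by (intro continuous_intros)

text \<open>Homogeneity reduces growth estimates to the unit circle. The identity survives at
  \<open>z = 0\<close>, where \<open>sgn 0 = 0\<close> and \<open>0 ^ 0 = 1\<close>.\<close>

lemma norm_p_poly: "norm (p_poly k \<alpha> z) = norm z ^ k * norm (p_poly k \<alpha> (sgn z))"
  using p_poly_scale[of k \<alpha> "norm z" "sgn z"]
  by (cases "z = 0") (simp_all add: sgn_eq norm_mult norm_power p_poly_def sgn_zero flip: of_real_power)

lemma p_poly_upper: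
  obtains B where "\<And>z. z \<noteq> 0 \<Longrightarrow> norm (p_poly k \<alpha> z) \<le> B * norm z ^ k"
proof -
  have "bounded (p_poly k \<alpha> ` sphere 0 1)"
    by (intro compact_imp_bounded compact_continuous_image continuous_on_p_poly) simp
  then obtain B where "\<forall>z\<in>sphere 0 1. norm (p_poly k \<alpha> z) \<le> B"
    by (auto simp: bounded_iff)
  then have "norm (p_poly k \<alpha> (sgn z)) \<le> B" if "z \<noteq> 0" for z
    using that by (simp add: norm_sgn)
  then have "norm (p_poly k \<alpha> z) \<le> B * norm z ^ k" if "z \<noteq> 0" for z
    using that by (subst norm_p_poly) (simp add: mult.commute mult_left_mono)
  then show thesis by (rule that)
qed

lemma p_poly_lower:
  assumes "\<alpha> > -1" "\<alpha> \<noteq> 0"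
  obtains \<delta> where "0 < \<delta>" "\<And>z. z \<noteq> 0 \<Longrightarrow> \<delta> * norm z ^ k \<le> norm (p_poly k \<alpha> z)"
proof -
  have "\<exists>x\<in>sphere 0 1. \<forall>y\<in>sphere 0 1. norm (p_poly k \<alpha> x) \<le> norm (p_poly k \<alpha> y)"
    by (intro continuous_attains_inf continuous_on_norm continuous_on_p_poly) auto
  then obtain x where x: "norm x = 1"
    and min: "\<And>y. norm y = 1 \<Longrightarrow> norm (p_poly k \<alpha> x) \<le> norm (p_poly k \<alpha> y)"
    by auto
  have "0 < norm (p_poly k \<alpha> x)"
    using p_poly_nonzero_on_circle[OF assms x] by simp
  moreover have "norm (p_poly k \<alpha> x) * norm z ^ k \<le> norm (p_poly k \<alpha> z)" if "z \<noteq> 0" for z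
    using min[of "sgn z"] that
    by (subst (2) norm_p_poly) (simp add: norm_sgn mult.commute mult_left_mono)
  ultimately show thesis by (rule that)
qed

lemma p_poly_over_higher_power_tendsto_0:
  assumes "k < m" and z: "filterlim (\<lambda>j. norm (z j)) at_top F"
  shows "((\<lambda>j. p_poly k \<alpha> (z j) / of_real (norm (z j) ^ m)) \<longlongrightarrow> 0) F"
proof -
  obtain B where B: "\<And>z. z \<noteq> 0 \<Longrightarrow> norm (p_poly k \<alpha> z) \<le> B * norm z ^ k"
    using p_poly_upper by blast
  have "((\<lambda>j. B / norm (z j) ^ (m - k)) \<longlongrightarrow> 0) F"
    using assms
    by (intro real_tendsto_divide_at_top[OF tendsto_const] filterlim_pow_at_top) auto
  moreover have "\<forall>\<^sub>F j in F. norm (p_poly k \<alpha> (z j) / of_real (norm (z j) ^ m))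
      \<le> B / norm (z j) ^ (m - k)"
    using eventually_compose_filterlim[OF eventually_gt_at_top[of 0] z]
  proof eventually_elim
    case (elim j)
    have "norm (z j) ^ m = norm (z j) ^ (m - k) * norm (z j) ^ k"
      using \<open>k < m\<close> by (simp flip: power_add)
    then show ?case
      using B[of "z j"] elim
      by (simp add: norm_divide norm_mult norm_power divide_simps)
  qed
  ultimately show ?thesis
    by (rule Lim_null_comparison[rotated])
qed

text \<open>Induction on the number of terms. After division by \<open>norm (z j) ^ n\<close> the
  lower terms die out by degree, while the top one stays at least
  \<open>norm (c n) * \<delta>\<close>. Once \<open>c n = 0\<close>, the undivided sum is the
  shorter one, so the induction hypothesis applies to it.\<close>

lemma p_poly_combination_tendsto_0_imp_coeffs_0:
  assumes \<alpha>: "\<alpha> > -1" "\<alpha> \<noteq> 0"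
    and z: "filterlim (\<lambda>j. norm (z j)) at_top F" and F: "F \<noteq> bot"
    and lim: "((\<lambda>j. \<Sum>k<n. c k * p_poly k \<alpha> (z j)) \<longlongrightarrow> 0) F"
  shows "\<forall>k<n. c k = 0"
  using lim
proof (induction n)
  case 0
  then show ?case by simp
next
  case (Suc n)
  let ?N = "\<lambda>j. complex_of_real (norm (z j) ^ n)"
  \<comment> \<open>Eventually \<open>norm (z j) \<ge> 1\<close>, so the division does not enlarge
    the norm and the limit remains 0.\<close>
  have "((\<lambda>j. inverse (norm (z j) ^ n) *\<^sub>R (\<Sum>k<Suc n. c k * p_poly k \<alpha> (z j))) \<longlongrightarrow> 0) F"
  proof (rule Lim_null_comparison[OF _ tendsto_norm_zero[OF Suc.prems]])
    show "\<forall>\<^sub>F j in F. norm (inverse (norm (z j) ^ n) *\<^sub>R (\<Sum>k<Suc n. c k * p_poly k \<alpha> (z j)))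
        \<le> norm (\<Sum>k<Suc n. c k * p_poly k \<alpha> (z j))"
      using eventually_compose_filterlim[OF eventually_ge_at_top[of 1] z]
    proof eventually_elim
      case (elim j)
      then have "inverse (norm (z j) ^ n) \<le> 1"
        by (simp add: inverse_le_1_iff one_le_power)
      then show ?case
        unfolding norm_scaleR by (intro mult_left_le_one_le) auto
    qed
  qed
  then have total: "((\<lambda>j. (\<Sum>k<Suc n. c k * p_poly k \<alpha> (z j)) / ?N j) \<longlongrightarrow> 0) F"
    by (simp add: scaleR_conv_of_real divide_inverse mult.commute)
  have "((\<lambda>j. \<Sum>k<n. c k * (p_poly k \<alpha> (z j) / ?N j)) \<longlongrightarrow> 0) F"
    by (intro tendsto_null_sum tendsto_mult_right_zero p_poly_over_higher_power_tendsto_0 z) simp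
  from tendsto_diff[OF total this]
  have top: "((\<lambda>j. c n * p_poly n \<alpha> (z j) / ?N j) \<longlongrightarrow> 0) F"
    by (simp add: add_divide_distrib sum_divide_distrib)
  obtain \<delta> where \<delta>: "0 < \<delta>" "\<And>z. z \<noteq> 0 \<Longrightarrow> \<delta> * norm z ^ n \<le> norm (p_poly n \<alpha> z)"
    using p_poly_lower[OF \<alpha>] by blast
  have "\<forall>\<^sub>F j in F. norm (c n) * \<delta> \<le> norm (c n * p_poly n \<alpha> (z j) / ?N j)"
    using eventually_compose_filterlim[OF eventually_gt_at_top[of 0] z]
  proof eventually_elim
    case (elim j)
    then have "\<delta> \<le> norm (p_poly n \<alpha> (z j)) / norm (z j) ^ n"
      using \<delta>(2)[of "z j"] by (simp add: field_simps)
    then have "norm (c n) * \<delta> \<le> norm (c n) * (norm (p_poly n \<alpha> (z j)) / norm (z j) ^ n)"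
      by (rule mult_left_mono) simp
    then show ?case by (simp add: norm_mult norm_divide norm_power)
  qed
  \<comment> \<open>A constant eventually below a null function is at most 0, because the filter is
    nontrivial.\<close>
  then have "norm (c n) * \<delta> \<le> 0"
    using tendsto_lowerbound[OF tendsto_norm_zero[OF top] _ F] by simp
  then have cn: "c n = 0"
    using \<delta>(1) by (simp add: mult_le_0_iff)
  then have "\<forall>k<n. c k = 0"
    using Suc.prems by (intro Suc.IH) simp
  with cn show ?case by (simp add: less_Suc_eq)
qed

theorem theorem6p4:
  fixes \<alpha> :: real and u :: "complex \<Rightarrow> complex" and z :: "nat \<Rightarrow> complex"
  assumes "\<alpha> > -1" and "\<alpha> \<noteq> 0"
    and "u \<in> V_space \<alpha>"
    and "\<And>j. z j \<in> upper_half_plane"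
    and "filterlim (\<lambda>j. norm (z j)) at_top sequentially"
    and "(\<lambda>j. u (z j) / of_real (Im (z j) powr (\<alpha> + 1))) \<longlonglongrightarrow> 0"
  shows "\<forall>w\<in>upper_half_plane. u w = 0"
proof -
  obtain n c where u: "\<And>w. w \<in> upper_half_plane \<Longrightarrow>
      u w = (\<Sum>k=0..n. c k * of_real (Im w powr (\<alpha> + 1)) * p_poly k \<alpha> w)"
    using assms(3) by (auto simp: V_space_def)
  \<comment> \<open>The power of \<open>Im (z j)\<close> is a nonzero common factor, so only a
    combination of the homogeneous polynomials remains.\<close>
  have "u (z j) / of_real (Im (z j) powr (\<alpha> + 1)) = (\<Sum>k<Suc n. c k * p_poly k \<alpha> (z j))" for j
  proof -
    have "Im (z j) > 0"
      using assms(4)[of j] by (simp add: upper_half_plane_def)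
    then show ?thesis
      unfolding u[OF assms(4)] sum_divide_distrib
      by (intro sum.cong) auto
  qed
  then have "(\<lambda>j. \<Sum>k<Suc n. c k * p_poly k \<alpha> (z j)) \<longlonglongrightarrow> 0"
    using assms(6) by simp
  from p_poly_combination_tendsto_0_imp_coeffs_0[OF assms(1,2,5) _ this]
  have "c k = 0" if "k \<le> n" for k
    using that by simp
  then show ?thesis using u by simp
qed

end
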